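(* Let $\epsilon>0$ be a constant. For the Online Vector Packing Problem (with non-negative monotone submodular utility and free disposal) in which every arriving item $u$ has weight vector $\mathbf{w}_u\in[0,1-\epsilon]^d$, there is a deterministic online algorithm, running in polynomial time, whose competitive ratio is $O(k/\epsilon^2)$, where $k$ is the (column) sparsity of the weight vectors.
   Context: Online Vector Packing Problem: there is a $d$-dimensional knapsack with capacity $1$ in each dimension. Items $u$ from a ground set $\Omega$ arrive online in an arbitrary (adversarial) order; the algorithm does not know the number of items in advance. Each item $u$ has a weight vector $\mathbf{w}_u\in[0,1]^d$, revealed upon arrival. Upon arrival of $u$, the algorithm must immediately decide whether to accept or discard $u$; it may also dispose of previously accepted items at no cost (free disposal), but discarded or disposed-of items can never be recovered. At all times the set $S$ of currently accepted items must be feasible: $\sum_{u\in S}\mathbf{w}_u\le \mathbf{1}$ coordinatewise. The utility of a set $S$ is $f(S)$, where $f:2^\Omega\to\mathbb{R}_+$ is a non-negative monotone submodular function (accessed via value queries). If $S$ is the final set kept by the algorithm, $\mathrm{ALG}=f(S)$, and the competitive ratio is the worst case over instances of $\mathrm{OPT}/\mathbb{E}[\mathrm{ALG}]\ge 1$, where $\mathrm{OPT}$ is the maximum of $f$ over feasible subsets of all arrived items. The sparsity $k$ is the minimum number such that every weight vector $\mathbf{w}_u$ has at most $k$ non-zero coordinates. *)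

theory Defs
  imports
    Complex_Main
    "HOL-Library.Extended_Nonnegative_Real"
    "HOL-Computational_Algebra.Polynomial"
begin

section \<open>Instances of Online Vector Packing\<close>

text \<open>Items are named by natural numbers. The name of an item is never shown to the algorithm and
  is unrelated to its position in the arrival order. The ground set need not be finite; the arrival
  sequence is. Dimensions are the naturals below \<open>dim\<close>.\<close>

record packing =
  dim :: nat
  ground :: "nat set"
  weight :: "nat \<Rightarrow> nat \<Rightarrow> real"
  utility :: "nat set \<Rightarrow> real"
  arrivals :: "nat list"

definition monotone_utility :: "'a set \<Rightarrow> ('a set \<Rightarrow> real) \<Rightarrow> bool" where
  "monotone_utility \<Omega> f \<longleftrightarrow> (\<forall>S T. S \<subseteq> T \<and> T \<subseteq> \<Omega> \<longrightarrow> f S \<le> f T)"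

definition submodular :: "'a set \<Rightarrow> ('a set \<Rightarrow> real) \<Rightarrow> bool" where
  "submodular \<Omega> f \<longleftrightarrow> (\<forall>S T. S \<subseteq> \<Omega> \<and> T \<subseteq> \<Omega> \<longrightarrow> f (S \<union> T) + f (S \<inter> T) \<le> f S + f T)"

definition packing_instance :: "packing \<Rightarrow> bool" where
  "packing_instance I \<longleftrightarrow>
     distinct (arrivals I) \<and> set (arrivals I) \<subseteq> ground I \<and>
     (\<forall>u\<in>set (arrivals I). \<forall>i<dim I. 0 \<le> weight I u i \<and> weight I u i \<le> 1) \<and>
     (\<forall>S. S \<subseteq> ground I \<longrightarrow> 0 \<le> utility I S) \<and>
     monotone_utility (ground I) (utility I) \<and> submodular (ground I) (utility I)"

definition has_slack :: "real \<Rightarrow> packing \<Rightarrow> bool" where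
  "has_slack \<epsilon> I \<longleftrightarrow>
     (\<forall>u\<in>set (arrivals I). \<forall>i<dim I. 0 \<le> weight I u i \<and> weight I u i \<le> 1 - \<epsilon>)"

definition sparsity :: "packing \<Rightarrow> nat" where
  "sparsity I = (LEAST k. \<forall>u\<in>set (arrivals I). card {i. i < dim I \<and> weight I u i \<noteq> 0} \<le> k)"

definition feasible :: "packing \<Rightarrow> nat set \<Rightarrow> bool" where
  "feasible I S \<longleftrightarrow> (\<forall>i<dim I. (\<Sum>u\<in>S. weight I u i) \<le> 1)"

definition opt_value :: "packing \<Rightarrow> real" where
  "opt_value I = Max (utility I ` {S. S \<subseteq> set (arrivals I) \<and> feasible I S})"


section \<open>The machine model: a unit-cost real RAM with value queries\<close>

text \<open>Natural-number variables serve for indices and counters and admit only addition and truncated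
  subtraction; two-dimensional arrays hold exact reals. There is no rounding and no passage from
  reals to naturals, and naturals are the only literals. All cells are initially 0.
  Division by 0 yields 0.\<close>

type_synonym vname = string

datatype nexp = NConst nat | NVar vname | NPlus nexp nexp | NMinus nexp nexp

datatype rexp =
    RNat nexp
  | RCell vname nexp nexp
  | RPlus rexp rexp
  | RMinus rexp rexp
  | RTimes rexp rexp
  | RDivide rexp rexp

datatype bexp = NLess nexp nexp | RLess rexp rexp | BNot bexp | BAnd bexp bexp

text \<open>\<open>Query x i j a r\<close> writes into cell \<open>(i, j)\<close> of array \<open>x\<close> the utility of the set of those arrived
  items whose arrival index \<open>m\<close> (counted from 0) satisfies \<open>a[r, m] \<noteq> 0\<close>.\<close>

datatype com =
    Skip
  | NAssign vname nexp
  | RAssign vname nexp nexp rexp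
  | Query vname nexp nexp vname nexp
  | Seq com com
  | Cond bexp com com
  | While bexp com

record store =
  nats :: "vname \<Rightarrow> nat"
  reals :: "vname \<Rightarrow> nat \<Rightarrow> nat \<Rightarrow> real"

fun nval :: "nexp \<Rightarrow> store \<Rightarrow> nat" where
  "nval (NConst n) s = n"
| "nval (NVar x) s = nats s x"
| "nval (NPlus a b) s = nval a s + nval b s"
| "nval (NMinus a b) s = nval a s - nval b s"

fun rval :: "rexp \<Rightarrow> store \<Rightarrow> real" where
  "rval (RNat a) s = real (nval a s)"
| "rval (RCell x i j) s = reals s x (nval i s) (nval j s)"
| "rval (RPlus a b) s = rval a s + rval b s"
| "rval (RMinus a b) s = rval a s - rval b s"
| "rval (RTimes a b) s = rval a s * rval b s"
| "rval (RDivide a b) s = rval a s / rval b s"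

fun bval :: "bexp \<Rightarrow> store \<Rightarrow> bool" where
  "bval (NLess a b) s \<longleftrightarrow> nval a s < nval b s"
| "bval (RLess a b) s \<longleftrightarrow> rval a s < rval b s"
| "bval (BNot b) s \<longleftrightarrow> \<not> bval b s"
| "bval (BAnd b c) s \<longleftrightarrow> bval b s \<and> bval c s"

definition set_nat :: "vname \<Rightarrow> nat \<Rightarrow> store \<Rightarrow> store" where
  "set_nat x n s = s\<lparr>nats := (nats s)(x := n)\<rparr>"

definition set_cell :: "vname \<Rightarrow> nat \<Rightarrow> nat \<Rightarrow> real \<Rightarrow> store \<Rightarrow> store" where
  "set_cell x i j v s =
     s\<lparr>reals := (reals s)(x := (reals s x)(i := (reals s x i)(j := v)))\<rparr>"

text \<open>\<open>exec q c s t s'\<close>: with value oracle \<open>q\<close>, the command \<open>c\<close> started in \<open>s\<close> terminates in \<open>s'\<close> after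
  \<open>t\<close> elementary steps. Evaluating an expression costs one step, since expressions are part of
  the fixed program text and thus have constant size.\<close>

inductive exec :: "((nat \<Rightarrow> bool) \<Rightarrow> real) \<Rightarrow> com \<Rightarrow> store \<Rightarrow> nat \<Rightarrow> store \<Rightarrow> bool"
  for q :: "(nat \<Rightarrow> bool) \<Rightarrow> real" where
  Skip: "exec q Skip s 1 s"
| NAssign: "exec q (NAssign x a) s 1 (set_nat x (nval a s) s)"
| RAssign: "exec q (RAssign x i j a) s 1 (set_cell x (nval i s) (nval j s) (rval a s) s)"
| Query: "exec q (Query x i j a r) s 1
            (set_cell x (nval i s) (nval j s) (q (\<lambda>m. reals s a (nval r s) m \<noteq> 0)) s)"
| Seq: "exec q c1 s t1 s1 \<Longrightarrow> exec q c2 s1 t2 s2 \<Longrightarrow> exec q (Seq c1 c2) s (t1 + t2) s2"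
| CondTrue: "bval b s \<Longrightarrow> exec q c1 s t s' \<Longrightarrow> exec q (Cond b c1 c2) s (Suc t) s'"
| CondFalse: "\<not> bval b s \<Longrightarrow> exec q c2 s t s' \<Longrightarrow> exec q (Cond b c1 c2) s (Suc t) s'"
| WhileFalse: "\<not> bval b s \<Longrightarrow> exec q (While b c) s 1 s"
| WhileTrue: "bval b s \<Longrightarrow> exec q c s t1 s1 \<Longrightarrow> exec q (While b c) s1 t2 s2 \<Longrightarrow>
    exec q (While b c) s (Suc (t1 + t2)) s2"

lemma exec_deterministic:
  "exec q c s t s' \<Longrightarrow> exec q c s u s'' \<Longrightarrow> u = t \<and> s'' = s'"
proof (induction arbitrary: u s'' rule: exec.induct)
  case (Seq c1 s t1 s1 c2 t2 s2)
  from Seq.prems show ?case by cases (use Seq.IH in blast)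
next
  case (CondTrue b s c1 t s' c2)
  from CondTrue.prems show ?case by cases (use CondTrue in blast)+
next
  case (CondFalse b s c2 t s' c1)
  from CondFalse.prems show ?case by cases (use CondFalse in blast)+
next
  case (WhileTrue b s c t1 s1 t2 s2)
  from WhileTrue.prems show ?case by cases (use WhileTrue in blast)+
qed (erule exec.cases; simp)+


section \<open>Online algorithms\<close>

text \<open>Only items that have arrived can be queried; they include discarded and disposed ones.\<close>

definition value_oracle :: "packing \<Rightarrow> nat list \<Rightarrow> (nat \<Rightarrow> bool) \<Rightarrow> real" where
  "value_oracle I us X = utility I {us ! m | m. m < length us \<and> X m}"

definition initial_store :: store where
  "initial_store = \<lparr>nats = (\<lambda>_. 0), reals = (\<lambda>_ _ _. 0)\<rparr>"

text \<open>What the algorithm is told on an arrival: the slack, the dimension, the index \<open>m\<close> of the arriving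
  item and its weight vector. The number of items and the sparsity are not revealed. The remaining
  memory persists from the previous arrival.\<close>

definition present :: "real \<Rightarrow> packing \<Rightarrow> nat \<Rightarrow> nat \<Rightarrow> store \<Rightarrow> store" where
  "present \<epsilon> I m u s =
     s\<lparr>nats := (nats s)(''d'' := dim I, ''t'' := m),
       reals := (reals s)(
         ''eps'' := (\<lambda>_ _. \<epsilon>),
         ''w'' := (\<lambda>_ i. if i < dim I then weight I u i else 0))\<rparr>"

text \<open>After each arrival the program exhibits the set it holds in row 0 of the array \<open>S\<close>.\<close>

definition kept :: "nat list \<Rightarrow> store \<Rightarrow> nat set" where
  "kept us s = {us ! m | m. m < length us \<and> reals s ''S'' 0 m \<noteq> 0}"

text \<open>\<open>online_run P \<epsilon> I us s Ss T\<close>: on the arrival sequence \<open>us\<close> the program \<open>P\<close> reaches the store \<open>s\<close> in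
  total time \<open>T\<close>, where \<open>Ss ! m\<close> is the set held after the first \<open>m\<close> arrivals.\<close>

inductive online_run ::
  "com \<Rightarrow> real \<Rightarrow> packing \<Rightarrow> nat list \<Rightarrow> store \<Rightarrow> nat set list \<Rightarrow> nat \<Rightarrow> bool"
  for P :: com and \<epsilon> :: real and I :: packing where
  start: "online_run P \<epsilon> I [] initial_store [{}] 0"
| arrive: "online_run P \<epsilon> I us s Ss T \<Longrightarrow>
    exec (value_oracle I (us @ [u])) P (present \<epsilon> I (length us) u s) t s' \<Longrightarrow>
    online_run P \<epsilon> I (us @ [u]) s' (Ss @ [kept (us @ [u]) s']) (T + t)"

lemma online_run_deterministic:
  "online_run P \<epsilon> I us s Ss T \<Longrightarrow> online_run P \<epsilon> I us s' Ss' T' \<Longrightarrow>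
    s' = s \<and> Ss' = Ss \<and> T' = T"
proof (induction arbitrary: s' Ss' T' rule: online_run.induct)
  case start
  then show ?case by cases auto
next
  case (arrive us s Ss T u t s1)
  from arrive.prems show ?case
  proof cases
    case (arrive us' s0 Ss0 T0 u' t')
    have eqs: "us' = us" "u' = u" using arrive(1) by auto
    with arrive.IH arrive(4) have prev: "s0 = s" "Ss0 = Ss" "T0 = T" by blast+
    with eqs arrive(5) arrive.hyps(2) have "t' = t \<and> s' = s1"
      using exec_deterministic by blast
    with eqs prev arrive(2,3) show ?thesis by simp
  qed simp
qed

text \<open>The second conjunct under the existential is irrevocability: an item held after an arrival was
  held before it or has just arrived.\<close>

definition online_algorithm :: "real \<Rightarrow> com \<Rightarrow> bool" where
  "online_algorithm \<epsilon> P \<longleftrightarrow>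
     (\<forall>I. packing_instance I \<and> has_slack \<epsilon> I \<longrightarrow>
       (\<exists>s Ss T. online_run P \<epsilon> I (arrivals I) s Ss T \<and>
         (\<forall>m<length (arrivals I). Ss ! Suc m \<subseteq> insert (arrivals I ! m) (Ss ! m)) \<and>
         (\<forall>S\<in>set Ss. feasible I S)))"

definition polynomial_time :: "real \<Rightarrow> com \<Rightarrow> bool" where
  "polynomial_time \<epsilon> P \<longleftrightarrow>
     (\<exists>p :: nat poly. \<forall>I s Ss T. packing_instance I \<and> has_slack \<epsilon> I \<and>
        online_run P \<epsilon> I (arrivals I) s Ss T \<longrightarrow>
        T \<le> poly p (length (arrivals I) + dim I))"

text \<open>Worst case of OPT/ALG over the instances of slack \<open>\<epsilon>\<close> and sparsity \<open>k\<close>. The quotient is taken in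
  \<open>ennreal\<close>, where \<open>x / 0 = \<infinity>\<close> for \<open>x > 0\<close> and \<open>0 / 0 = 0\<close>: a positive optimum against a
  worthless solution counts as infinitely bad, and instances of optimum 0 impose nothing.\<close>

definition competitive_ratio :: "real \<Rightarrow> com \<Rightarrow> nat \<Rightarrow> ennreal" where
  "competitive_ratio \<epsilon> P k =
     Sup {ennreal (opt_value I) / ennreal (utility I (last Ss)) | I s Ss T.
       packing_instance I \<and> has_slack \<epsilon> I \<and> sparsity I = k \<and>
       online_run P \<epsilon> I (arrivals I) s Ss T}"

end

theory Submission
  imports Defs
begin

text \<open>Let \<open>A\<close> be the set of all items ever accepted, let the gain \<open>v\<^sub>u\<close> of \<open>u\<close> be its marginal utility with
  respect to the items accepted before \<open>u\<close>, and let \<open>X\<^sub>i\<close> be the total gain of the accepted items that use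
  dimension \<open>i\<close>. Accept \<open>u\<close> iff \<open>\<epsilon> v\<^sub>u \<ge> 2 (\<Sum>i. w\<^sub>u(i) X\<^sub>i)\<close>; when dimension \<open>i\<close> overflows, dispose of the
  oldest items that use it. By the slack, an item \<open>z\<close> disposed of on account of dimension \<open>i\<close> is followed by
  accepted items of weight at least \<open>\<epsilon>\<close> in dimension \<open>i\<close>, and the value charged to them there is at
  least twice the gain of everything older that uses dimension \<open>i\<close>. Summing over the dimensions, the gain lost by
  disposal is at most half the gain of \<open>A\<close>. The rejected items of an optimal solution have total gain at
  most \<open>(2/\<epsilon>) (\<Sum>i. X\<^sub>i) \<le> (2k/\<epsilon>) v(A)\<close>, so the ratio is at most \<open>2 + 4k/\<epsilon>\<close>.\<close>

section \<open>Gains, prices and the competitive analysis\<close>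

locale slack_instance =
  fixes I :: packing and \<epsilon> :: real
  assumes inst: "packing_instance I" and slack: "has_slack \<epsilon> I"
    and eps_pos: "0 < \<epsilon>" and eps_le_1: "\<epsilon> \<le> 1"
begin

abbreviation n :: nat where "n \<equiv> length (arrivals I)"

definition items :: "nat set \<Rightarrow> nat set" where
  "items X = (!) (arrivals I) ` X"

definition val :: "nat set \<Rightarrow> real" where
  "val X = utility I (items X)"

definition wt :: "nat \<Rightarrow> nat \<Rightarrow> real" where
  "wt j i = weight I (arrivals I ! j) i"

text \<open>Cutting \<open>A\<close> at \<open>j\<close> makes the gain independent of later
  decisions. The final \<open>A\<close> thus reproduces the marginal seen on arrival, for accepted
  and rejected \<open>j\<close> alike.\<close>

definition gain :: "nat set \<Rightarrow> nat \<Rightarrow> real" where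
  "gain A j = val (insert j (A \<inter> {..<j})) - val (A \<inter> {..<j})"

definition stock :: "nat set \<Rightarrow> nat \<Rightarrow> nat \<Rightarrow> real" where
  "stock A j i = (\<Sum>l\<in>{l \<in> A. l < j \<and> 0 < wt l i}. gain A l)"

definition price :: "nat set \<Rightarrow> nat \<Rightarrow> real" where
  "price A j = (\<Sum>i<dim I. wt j i * stock A j i)"

text \<open>Everything accepted after \<open>j\<close> counts, whether still held or not, so the
  property survives later disposals and the growth of \<open>A\<close>.\<close>

definition superseded :: "nat set \<Rightarrow> nat \<Rightarrow> nat \<Rightarrow> bool" where
  "superseded A i j \<longleftrightarrow> 0 < wt j i \<and> \<epsilon> \<le> (\<Sum>l\<in>{l \<in> A. j < l}. wt l i)"

text \<open>The interface between program and analysis. The third conjunct reads the acceptance rule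
  off \<open>A\<close> itself; the fourth gives every disposed item a dimension to blame.\<close>

definition good :: "nat \<Rightarrow> nat set \<Rightarrow> nat set \<Rightarrow> bool" where
  "good m A S \<longleftrightarrow> S \<subseteq> A \<and> A \<subseteq> {..<m} \<and>
     (\<forall>j<m. j \<in> A \<longleftrightarrow> 2 * price A j \<le> \<epsilon> * gain A j) \<and>
     (\<forall>j\<in>A - S. \<exists>i<dim I. superseded A i j) \<and>
     (\<forall>i<dim I. (\<Sum>l\<in>S. wt l i) \<le> 1)"

section \<open>Utilities and weights on arrival indices\<close>

lemma inj_arrivals: "X \<subseteq> {..<n} \<Longrightarrow> inj_on ((!) (arrivals I)) X"
  using inst by (intro inj_onI) (auto simp: packing_instance_def nth_eq_iff_index_eq subset_iff)

lemma items_subset: "X \<subseteq> {..<n} \<Longrightarrow> items X \<subseteq> ground I"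
  using inst by (auto simp: packing_instance_def items_def subset_iff)

lemma wt_nonneg: "j < n \<Longrightarrow> i < dim I \<Longrightarrow> 0 \<le> wt j i"
  using slack by (auto simp: has_slack_def wt_def)

lemma wt_le: "j < n \<Longrightarrow> i < dim I \<Longrightarrow> wt j i \<le> 1 - \<epsilon>"
  using slack by (auto simp: has_slack_def wt_def)

lemma val_nonneg: "X \<subseteq> {..<n} \<Longrightarrow> 0 \<le> val X"
  using inst items_subset by (auto simp: packing_instance_def val_def)

lemma val_mono: "X \<subseteq> Y \<Longrightarrow> Y \<subseteq> {..<n} \<Longrightarrow> val X \<le> val Y"
  using inst items_subset[of Y]
  by (auto simp: packing_instance_def val_def monotone_utility_def items_def image_mono)

text \<open>For \<open>j \<notin> Y\<close> this is submodularity of \<open>insert j X\<close> and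
  \<open>Y\<close>, whose union and intersection are \<open>insert j Y\<close> and \<open>X\<close>.
  For \<open>j \<in> Y\<close> the left side is 0 and monotonicity suffices.\<close>

lemma val_diminishing:
  assumes "X \<subseteq> Y" "Y \<subseteq> {..<n}" "j < n"
  shows "val (insert j Y) - val Y \<le> val (insert j X) - val X"
proof (cases "j \<in> Y")
  case True
  have "val X \<le> val (insert j X)" using assms by (intro val_mono) auto
  then show ?thesis using True by (simp add: insert_absorb)
next
  case False
  have sub: "insert j X \<subseteq> {..<n}" "insert j Y \<subseteq> {..<n}" using assms by auto
  have "items (insert j X) \<union> items Y = items (insert j Y)"
    using assms(1) by (auto simp: items_def)
  \<comment> \<open>Passing from indices to items preserves the intersection because arrivals are
    distinct.\<close>
  moreover have "items (insert j X) \<inter> items Y = items X"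
  proof -
    have "insert j X \<inter> Y = X" using assms(1) False by auto
    then show ?thesis
      unfolding items_def using inj_on_image_Int[OF inj_arrivals[OF sub(2)], of "insert j X" Y] assms(1)
      by (simp add: insert_mono subset_insertI subset_insertI2)
  qed
  moreover have "utility I (items (insert j X) \<union> items Y) + utility I (items (insert j X) \<inter> items Y)
      \<le> utility I (items (insert j X)) + utility I (items Y)"
    using inst items_subset[OF sub(1)] items_subset[OF assms(2)]
    unfolding packing_instance_def submodular_def by blast
  ultimately show ?thesis by (simp add: val_def)
qed

section \<open>Gains, stocks and telescoping sums\<close>

lemma gain_nonneg: "j < n \<Longrightarrow> 0 \<le> gain A j"
proof -
  assume "j < n"
  then have "val (A \<inter> {..<j}) \<le> val (insert j (A \<inter> {..<j}))" by (intro val_mono) auto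
  then show ?thesis by (simp add: gain_def)
qed

lemma gain_cong: "A \<inter> {..<j} = B \<inter> {..<j} \<Longrightarrow> gain A j = gain B j"
  by (simp add: gain_def)

lemma stock_cong:
  assumes "A \<inter> {..<j} = B \<inter> {..<j}"
  shows "stock A j i = stock B j i"
  unfolding stock_def
proof (rule sum.cong)
  show "{l \<in> A. l < j \<and> 0 < wt l i} = {l \<in> B. l < j \<and> 0 < wt l i}" using assms by blast
  show "gain A l = gain B l" if "l \<in> {l \<in> B. l < j \<and> 0 < wt l i}" for l
  proof (rule gain_cong)
    have "{..<l} = {..<j} \<inter> {..<l}" using that by auto
    then show "A \<inter> {..<l} = B \<inter> {..<l}" using assms by blast
  qed
qed

lemma price_cong: "A \<inter> {..<j} = B \<inter> {..<j} \<Longrightarrow> price A j = price B j"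
  unfolding price_def by (intro sum.cong arg_cong2[where f = times] stock_cong refl)

lemma stock_Suc:
  "stock A (Suc j) i = stock A j i + (if j \<in> A \<and> 0 < wt j i then gain A j else 0)"
proof (cases "j \<in> A \<and> 0 < wt j i")
  case True
  then have "{l \<in> A. l < Suc j \<and> 0 < wt l i} = insert j {l \<in> A. l < j \<and> 0 < wt l i}"
    by auto
  then show ?thesis using True unfolding stock_def by simp
next
  case False
  then have "{l \<in> A. l < Suc j \<and> 0 < wt l i} = {l \<in> A. l < j \<and> 0 < wt l i}"
    by (auto simp: less_Suc_eq)
  then show ?thesis using False unfolding stock_def by auto
qed

lemma stock_nonneg: "j \<le> n \<Longrightarrow> 0 \<le> stock A j i"
  unfolding stock_def by (intro sum_nonneg gain_nonneg) auto

lemma val_sum_gain: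
  "val (A \<inter> {..<m}) = val {} + (\<Sum>j\<in>A \<inter> {..<m}. gain A j)"
proof (induction m)
  case (Suc m)
  have "A \<inter> {..<Suc m} = (if m \<in> A then insert m else id) (A \<inter> {..<m})"
    by (auto simp: less_Suc_eq)
  then show ?case using Suc by (simp add: gain_def)
qed simp

text \<open>Dropping items of \<open>A\<close> can only raise the marginals of those that stay, so a
  kept set is worth at least the gains measured against the larger \<open>A\<close>.\<close>

lemma val_ge_sum_gain:
  assumes "S \<subseteq> A" "m \<le> n"
  shows "val {} + (\<Sum>j\<in>S \<inter> {..<m}. gain A j) \<le> val (S \<inter> {..<m})"
  using assms(2)
proof (induction m)
  case (Suc m)
  have eq: "S \<inter> {..<Suc m} = (if m \<in> S then insert m else id) (S \<inter> {..<m})"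
    by (auto simp: less_Suc_eq)
  have "gain A m \<le> val (insert m (S \<inter> {..<m})) - val (S \<inter> {..<m})"
    unfolding gain_def using assms(1) Suc.prems by (intro val_diminishing) auto
  then show ?case using Suc unfolding eq by simp
qed simp

text \<open>The items of \<open>T\<close> are added one by one on top of \<open>A\<close>. Each is
  added to a superset of the prefix of \<open>A\<close> that its gain refers to, so diminishing
  returns apply.\<close>

lemma val_union_le:
  assumes "finite T" "T \<subseteq> {..<n}" "A \<subseteq> {..<n}"
  shows "val (A \<union> T) \<le> val A + (\<Sum>j\<in>T - A. gain A j)"
  using assms(1,2)
proof (induction T)
  case (insert x T)
  have *: "val (insert x (A \<union> T)) - val (A \<union> T) \<le> gain A x"
    unfolding gain_def using insert.prems assms(3) by (intro val_diminishing) auto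
  show ?case
  proof (cases "x \<in> A")
    case True
    then show ?thesis using insert by (simp add: insert_absorb)
  next
    case False
    then have "insert x T - A = insert x (T - A)" by auto
    then show ?thesis using insert * by simp
  qed
qed simp

section \<open>Charging the disposed items\<close>

text \<open>The youngest superseded item \<open>z\<close> settles all of them at once: the others
  are older and use dimension \<open>i\<close> too, so all count in the stock faced by each item
  accepted after \<open>z\<close>, and those items weigh at least \<epsilon> together.\<close>

lemma superseded_gain_le:
  assumes A: "A \<subseteq> {..<n}" and i: "i < dim I"
  shows "\<epsilon> * (\<Sum>j\<in>{j \<in> A. superseded A i j}. gain A j) \<le> (\<Sum>l\<in>A. wt l i * stock A l i)"
proof -
  let ?D = "{j \<in> A. superseded A i j}"
  have fin: "finite A" "finite ?D" using finite_subset[OF A] by auto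
  have wt0: "0 \<le> wt l i" "0 \<le> stock A l i" if "l \<in> A" for l
    using that A i wt_nonneg stock_nonneg by (auto simp: subset_iff less_imp_le)
  show ?thesis
  proof (cases "?D = {}")
    case True
    have "0 \<le> (\<Sum>l\<in>A. wt l i * stock A l i)" using wt0 by (intro sum_nonneg) simp
    then show ?thesis unfolding True by simp
  next
    case False
    define z where "z = Max ?D"
    have z: "z \<in> ?D" using fin False unfolding z_def by (intro Max_in)
    have le_z: "j \<le> z" if "j \<in> ?D" for j using fin that unfolding z_def by simp
    let ?G = "\<Sum>j\<in>?D. gain A j"
    have G: "?G \<le> stock A l i" if "l \<in> A" "z < l" for l
      unfolding stock_def
    proof (rule sum_mono2)
      show "?D \<subseteq> {x \<in> A. x < l \<and> 0 < wt x i}"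
        using le_z that by (fastforce simp: superseded_def)
    qed (use A that gain_nonneg fin in auto)
    have "0 \<le> ?G" using A gain_nonneg by (intro sum_nonneg) auto
    then have "\<epsilon> * ?G \<le> (\<Sum>l\<in>{l \<in> A. z < l}. wt l i) * ?G"
      using z by (intro mult_right_mono) (auto simp: superseded_def)
    also have "\<dots> \<le> (\<Sum>l\<in>{l \<in> A. z < l}. wt l i * stock A l i)"
      unfolding sum_distrib_right using wt0 G by (intro sum_mono mult_left_mono) auto
    also have "\<dots> \<le> (\<Sum>l\<in>A. wt l i * stock A l i)"
      using wt0 fin by (intro sum_mono2) auto
    finally show ?thesis .
  qed
qed

lemma good_gain_le:
  assumes "good n A S"
  shows "(\<Sum>j\<in>A. gain A j) \<le> 2 * (\<Sum>j\<in>S. gain A j)"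
proof -
  have A: "A \<subseteq> {..<n}" and SA: "S \<subseteq> A" using assms by (auto simp: good_def)
  have fin: "finite A" using A finite_subset by auto
  have g0: "0 \<le> gain A j" if "j \<in> A" for j using that A gain_nonneg by auto
  \<comment> \<open>Union bound over the dimensions: an item superseded in several of them is
    counted once for each.\<close>
  have "(\<Sum>j\<in>A - S. gain A j) \<le> (\<Sum>j\<in>A. \<Sum>i<dim I. if superseded A i j then gain A j else 0)"
  proof -
    have "gain A j \<le> (\<Sum>i<dim I. if superseded A i j then gain A j else 0)" if j: "j \<in> A - S" for j
    proof -
      obtain i where i: "i < dim I" "superseded A i j" using assms j unfolding good_def by blast
      show ?thesis using member_le_sum[of i "{..<dim I}" "\<lambda>i. if superseded A i j then gain A j else 0"]
          i j g0 by simp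
    qed
    then have "(\<Sum>j\<in>A - S. gain A j) \<le> (\<Sum>j\<in>A - S. \<Sum>i<dim I. if superseded A i j then gain A j else 0)"
      by (rule sum_mono)
    also have "\<dots> \<le> (\<Sum>j\<in>A. \<Sum>i<dim I. if superseded A i j then gain A j else 0)"
      using fin g0 by (intro sum_mono2 sum_nonneg) auto
    finally show ?thesis .
  qed
  also have "\<dots> = (\<Sum>i<dim I. \<Sum>j\<in>{j \<in> A. superseded A i j}. gain A j)"
    by (subst sum.swap) (simp add: sum.inter_filter[OF fin])
  finally have "\<epsilon> * (\<Sum>j\<in>A - S. gain A j) \<le> (\<Sum>i<dim I. \<epsilon> * (\<Sum>j\<in>{j \<in> A. superseded A i j}. gain A j))"
    using eps_pos by (simp add: sum_distrib_left[symmetric])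
  also have "\<dots> \<le> (\<Sum>i<dim I. \<Sum>l\<in>A. wt l i * stock A l i)"
    using superseded_gain_le[OF A] by (intro sum_mono) simp
  also have "\<dots> = (\<Sum>l\<in>A. price A l)" unfolding price_def by (rule sum.swap)
  \<comment> \<open>The factor 2 of the acceptance rule is spent here; it limits the loss to half of
    the total gain.\<close>
  also have "\<dots> \<le> (\<Sum>l\<in>A. \<epsilon> * gain A l / 2)"
    using assms A by (intro sum_mono) (auto simp: good_def subset_iff)
  also have "\<dots> = \<epsilon> * ((\<Sum>l\<in>A. gain A l) / 2)"
    by (simp add: sum_distrib_left sum_divide_distrib)
  finally have "(\<Sum>j\<in>A - S. gain A j) \<le> (\<Sum>l\<in>A. gain A l) / 2"
    using eps_pos by simp
  then show ?thesis using sum.subset_diff[OF SA fin, of "gain A"] by simp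
qed

section \<open>Charging the rejected items\<close>

lemma sparsity_bound:
  "j < n \<Longrightarrow> card {i. i < dim I \<and> wt j i \<noteq> 0} \<le> sparsity I"
proof -
  let ?P = "\<lambda>k. \<forall>u\<in>set (arrivals I). card {i. i < dim I \<and> weight I u i \<noteq> 0} \<le> k"
  have "card {i. i < dim I \<and> weight I u i \<noteq> 0} \<le> dim I" for u
    using card_mono[of "{..<dim I}" "{i. i < dim I \<and> weight I u i \<noteq> 0}"] by auto
  \<comment> \<open>\<open>dim I\<close> witnesses that the set under \<open>LEAST\<close> is
    nonempty.\<close>
  then have "?P (sparsity I)" unfolding sparsity_def by (intro LeastI[of ?P "dim I"]) blast
  then show "j < n \<Longrightarrow> ?thesis" unfolding wt_def by simp
qed

text \<open>After exchanging the sums, each accepted item contributes its gain once per dimension it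
  uses; this is where the sparsity enters.\<close>

lemma sum_stock_le:
  assumes A: "A \<subseteq> {..<n}"
  shows "(\<Sum>i<dim I. stock A n i) \<le> real (sparsity I) * (\<Sum>j\<in>A. gain A j)"
proof -
  have fin: "finite A" using A finite_subset by auto
  have "stock A n i = (\<Sum>l\<in>A. if 0 < wt l i then gain A l else 0)" for i
  proof -
    have "{l \<in> A. l < n \<and> 0 < wt l i} = {l \<in> A. 0 < wt l i}" using A by auto
    then show ?thesis unfolding stock_def by (simp add: sum.inter_filter[OF fin])
  qed
  then have "(\<Sum>i<dim I. stock A n i) = (\<Sum>l\<in>A. \<Sum>i<dim I. if 0 < wt l i then gain A l else 0)"
    by (simp add: sum.swap[of _ A])
  also have "\<dots> \<le> (\<Sum>l\<in>A. real (sparsity I) * gain A l)"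
  proof (rule sum_mono)
    fix l assume "l \<in> A"
    then have l: "l < n" using A by auto
    have "(\<Sum>i<dim I. if 0 < wt l i then gain A l else 0) = real (card {i \<in> {..<dim I}. 0 < wt l i}) * gain A l"
      by (simp add: sum.inter_filter[symmetric])
    also have "{i \<in> {..<dim I}. 0 < wt l i} = {i. i < dim I \<and> wt l i \<noteq> 0}"
      using wt_nonneg[OF l] by force
    also have "real (card \<dots>) * gain A l \<le> real (sparsity I) * gain A l"
      using sparsity_bound[OF l] gain_nonneg[OF l] by (intro mult_right_mono) auto
    finally show "(\<Sum>i<dim I. if 0 < wt l i then gain A l else 0) \<le> real (sparsity I) * gain A l" .
  qed
  finally show ?thesis by (simp add: sum_distrib_left)
qed

text \<open>Rejection bounds \<epsilon> times the gain by twice the price. Stocks only grow, so all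
  prices may be taken at the final stocks, which do not depend on \<open>j\<close>; then feasibility
  of \<open>T\<close> leaves at most one unit of weight per dimension.\<close>

lemma rejected_gain_le:
  assumes good: "good n A S" and T: "T \<subseteq> {..<n}"
    and feas: "\<And>i. i < dim I \<Longrightarrow> (\<Sum>j\<in>T. wt j i) \<le> 1"
  shows "\<epsilon> * (\<Sum>j\<in>T - A. gain A j) \<le> 2 * (real (sparsity I) * (\<Sum>j\<in>A. gain A j))"
proof -
  have A: "A \<subseteq> {..<n}" using good by (auto simp: good_def)
  have fin: "finite T" "finite A" using A T finite_subset by auto
  have mono: "stock A j i \<le> stock A n i" if "j < n" for i j
    unfolding stock_def using that A gain_nonneg fin by (intro sum_mono2) auto
  have "\<epsilon> * (\<Sum>j\<in>T - A. gain A j) \<le> (\<Sum>j\<in>T - A. 2 * price A j)"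
    unfolding sum_distrib_left using good T by (intro sum_mono) (force simp: good_def)
  also have "\<dots> \<le> (\<Sum>j\<in>T - A. 2 * (\<Sum>i<dim I. wt j i * stock A n i))"
    unfolding price_def using mono wt_nonneg T by (intro sum_mono mult_left_mono) auto
  also have "\<dots> = 2 * (\<Sum>i<dim I. (\<Sum>j\<in>T - A. wt j i) * stock A n i)"
    by (simp add: sum_distrib_left sum_distrib_right sum.swap[of _ "T - A"])
  also have "\<dots> \<le> 2 * (\<Sum>i<dim I. stock A n i)"
  proof (intro mult_left_mono sum_mono)
    fix i assume i: "i \<in> {..<dim I}"
    have "(\<Sum>j\<in>T - A. wt j i) \<le> (\<Sum>j\<in>T. wt j i)"
      using fin T wt_nonneg i by (intro sum_mono2) auto
    also have "\<dots> \<le> 1" using feas i by auto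
    finally show "(\<Sum>j\<in>T - A. wt j i) * stock A n i \<le> stock A n i"
      using stock_nonneg[of n A i] mult_right_mono[of _ 1 "stock A n i"] by fastforce
  qed simp
  also have "\<dots> \<le> 2 * (real (sparsity I) * (\<Sum>j\<in>A. gain A j))"
    using sum_stock_le[OF A] by simp
  finally show ?thesis .
qed

section \<open>The ratio for a good pair of accepted and held sets\<close>

lemma good_competitive:
  assumes good: "good n A S" and T: "T \<subseteq> {..<n}"
    and feas: "\<And>i. i < dim I \<Longrightarrow> (\<Sum>j\<in>T. wt j i) \<le> 1"
  shows "val T \<le> (2 + 4 * real (sparsity I) / \<epsilon>) * val S"
proof -
  have A: "A \<subseteq> {..<n}" and SA: "S \<subseteq> A" using good by (auto simp: good_def)
  have fin: "finite T" using T finite_subset by auto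
  have Sn: "S \<inter> {..<n} = S" "A \<inter> {..<n} = A" using A SA by auto
  let ?v = "\<lambda>X. \<Sum>j\<in>X. gain A j" and ?k = "real (sparsity I)"
  have v0: "0 \<le> val {}" using val_nonneg by simp
  have vS: "val {} + ?v S \<le> val S" using val_ge_sum_gain[OF SA order_refl] Sn by simp
  have half: "?v A \<le> 2 * ?v S" by (rule good_gain_le[OF good])
  have "\<epsilon> * ?v (T - A) \<le> 2 * (?k * ?v A)" by (rule rejected_gain_le[OF good T feas])
  also have "\<dots> \<le> 2 * (?k * (2 * val S))"
    using half v0 vS by (intro mult_left_mono) auto
  finally have rej: "?v (T - A) \<le> 4 * ?k / \<epsilon> * val S"
    using eps_pos by (simp add: field_simps)
  have "val T \<le> val (A \<union> T)" using A T by (intro val_mono) auto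
  also have "\<dots> \<le> val A + ?v (T - A)" by (rule val_union_le[OF fin T A])
  also have "val A = val {} + ?v A" using val_sum_gain[of A n] Sn by simp
  \<comment> \<open>A nonzero utility of the empty set is absorbed: \<open>val {} + ?v A\<close> is
    at most twice \<open>val {} + ?v S\<close>, because \<open>val {}\<close> is
    nonnegative.\<close>
  finally have "val T \<le> 2 * val S + 4 * ?k / \<epsilon> * val S" using half rej v0 vS by linarith
  then show ?thesis by (simp add: algebra_simps)
qed

lemma opt_le:
  assumes "good n A S"
  shows "opt_value I \<le> (2 + 4 * real (sparsity I) / \<epsilon>) * val S"
proof -
  let ?F = "{S. S \<subseteq> set (arrivals I) \<and> feasible I S}"
  have "{} \<in> ?F" by (simp add: feasible_def)
  moreover have "finite ?F" by (rule finite_subset[of _ "Pow (set (arrivals I))"]) auto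
  ultimately have "opt_value I \<in> utility I ` ?F"
    unfolding opt_value_def by (intro Max_in) auto
  then obtain U where U: "U \<subseteq> set (arrivals I)" "feasible I U" "opt_value I = utility I U" by auto
  \<comment> \<open>The optimum as a set of arrival indices; by distinctness its loads are
    unchanged.\<close>
  define T where "T = {j. j < n \<and> arrivals I ! j \<in> U}"
  have T: "T \<subseteq> {..<n}" "items T = U"
    using U(1) by (auto simp: T_def items_def in_set_conv_nth subset_iff image_iff)
  have "(\<Sum>j\<in>T. wt j i) \<le> 1" if "i < dim I" for i
  proof -
    have "(\<Sum>u\<in>U. weight I u i) = (\<Sum>j\<in>T. wt j i)"
      using sum.reindex[OF inj_arrivals[OF T(1)], of "\<lambda>u. weight I u i"] T(2)
      by (simp add: items_def wt_def)
    moreover have "(\<Sum>u\<in>U. weight I u i) \<le> 1" using U(2) that by (simp add: feasible_def)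
    ultimately show ?thesis by simp
  qed
  from good_competitive[OF assms T(1) this] show ?thesis using U(3) T(2) by (simp add: val_def)
qed

end

section \<open>Total correctness with running time\<close>

text \<open>A weakest precondition with a time budget. The store comes last so that
  \<open>runs q c2 T2 Q\<close> can itself serve as a postcondition; as execution is deterministic,
  exhibiting one execution suffices.\<close>

definition runs :: "((nat \<Rightarrow> bool) \<Rightarrow> real) \<Rightarrow> com \<Rightarrow> nat \<Rightarrow> (store \<Rightarrow> bool) \<Rightarrow> store \<Rightarrow> bool" where
  "runs q c T Q s \<longleftrightarrow> (\<exists>t s'. exec q c s t s' \<and> t \<le> T \<and> Q s')"

definition for_loop :: "vname \<Rightarrow> nexp \<Rightarrow> com \<Rightarrow> com" where
  "for_loop x b c = Seq (NAssign x (NConst 0))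
     (While (NLess (NVar x) b) (Seq c (NAssign x (NPlus (NVar x) (NConst 1)))))"

lemma nats_set_nat [simp]: "nats (set_nat x k s) y = (if x = y then k else nats s y)"
  and reals_set_nat [simp]: "reals (set_nat x k s) = reals s"
  and nats_set_cell [simp]: "nats (set_cell x i j v s) = nats s"
  and reals_set_cell [simp]:
    "reals (set_cell x i j v s) y a b = (if x = y \<and> i = a \<and> j = b then v else reals s y a b)"
  by (auto simp: set_nat_def set_cell_def)

lemma runs_mono:
  "runs q c T Q s \<Longrightarrow> T \<le> T' \<Longrightarrow> (\<And>s'. Q s' \<Longrightarrow> Q' s') \<Longrightarrow> runs q c T' Q' s"
  unfolding runs_def by (meson order_trans)

lemma runs_Skip: "Q s \<Longrightarrow> 1 \<le> T \<Longrightarrow> runs q Skip T Q s"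
  unfolding runs_def using exec.Skip by blast

lemma runs_RAssign:
  "Q (set_cell x (nval i s) (nval j s) (rval a s) s) \<Longrightarrow> runs q (RAssign x i j a) 1 Q s"
  unfolding runs_def using exec.RAssign by blast

lemma runs_Query:
  "Q (set_cell x (nval i s) (nval j s) (q (\<lambda>m. reals s a (nval r s) m \<noteq> 0)) s) \<Longrightarrow>
    runs q (Query x i j a r) 1 Q s"
  unfolding runs_def using exec.Query by blast

lemma runs_Seq:
  "runs q c1 T1 (runs q c2 T2 Q) s \<Longrightarrow> runs q (Seq c1 c2) (T1 + T2) Q s"
  unfolding runs_def using exec.Seq add_mono by blast

lemma runs_Cond:
  assumes "bval b s \<Longrightarrow> runs q c1 T Q s" "\<not> bval b s \<Longrightarrow> runs q c2 T Q s"
  shows "runs q (Cond b c1 c2) (Suc T) Q s"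
  using assms unfolding runs_def by (meson Suc_le_mono exec.CondTrue exec.CondFalse)

text \<open>The invariant for \<open>j\<close> is asserted with the counter already set to
  \<open>j\<close>, and the body must hand the counter back unchanged. A round pays for test, body
  and increment; the final 2 covers the initial assignment and the failing test.\<close>

lemma runs_for_loop:
  assumes init: "Inv 0 (set_nat x 0 s)"
    and body: "\<And>j s. j < N \<Longrightarrow> Inv j s \<Longrightarrow> nats s x = j \<Longrightarrow>
      runs q c T (\<lambda>s'. nats s' x = j \<and> Inv (Suc j) (set_nat x (Suc j) s')) s"
    and bound: "\<And>j s. Inv j s \<Longrightarrow> nval b s = N"
    and final: "\<And>s. Inv N s \<Longrightarrow> Q s"
  shows "runs q (for_loop x b c) (N * (T + 2) + 2) Q s"
proof -
  let ?W = "While (NLess (NVar x) b) (Seq c (NAssign x (NPlus (NVar x) (NConst 1))))"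
  \<comment> \<open>Induction on the number \<open>k\<close> of rounds still to come.\<close>
  have loop: "runs q ?W (k * (T + 2) + 1) Q s" if "Inv (N - k) s" "nats s x = N - k" "k \<le> N" for k s
    using that
  proof (induction k arbitrary: s)
    case 0
    have "exec q ?W s 1 s" by (rule exec.WhileFalse) (use 0 bound in auto)
    then show ?case unfolding runs_def using 0 final by auto
  next
    case (Suc k)
    let ?j = "N - Suc k"
    have j: "?j < N" "Suc ?j = N - k" using Suc.prems by auto
    obtain t s1 where s1: "exec q c s t s1" "t \<le> T" "nats s1 x = ?j" "Inv (N - k) (set_nat x (N - k) s1)"
      using body[OF j(1) Suc.prems(1,2)] unfolding runs_def j(2) by blast
    have "exec q (NAssign x (NPlus (NVar x) (NConst 1))) s1 1 (set_nat x (N - k) s1)"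
      using exec.NAssign[of q x "NPlus (NVar x) (NConst 1)" s1] s1(3) j(2) by simp
    then have e: "exec q (Seq c (NAssign x (NPlus (NVar x) (NConst 1)))) s (t + 1) (set_nat x (N - k) s1)"
      by (rule exec.Seq[OF s1(1)])
    obtain u s2 where s2: "exec q ?W (set_nat x (N - k) s1) u s2" "u \<le> k * (T + 2) + 1" "Q s2"
      using Suc.IH[OF s1(4)] Suc.prems(3) unfolding runs_def by auto
    have "exec q ?W s (Suc ((t + 1) + u)) s2"
      by (rule exec.WhileTrue[OF _ e s2(1)]) (use Suc.prems bound j in auto)
    then show ?case unfolding runs_def using s1(2) s2 by (intro exI conjI) auto
  qed
  have "runs q ?W (N * (T + 2) + 1) Q (set_nat x 0 s)" using loop[of N] init by simp
  then obtain t s' where "exec q ?W (set_nat x 0 s) t s'" "t \<le> N * (T + 2) + 1" "Q s'"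
    unfolding runs_def by blast
  moreover have "exec q (NAssign x (NConst 0)) s 1 (set_nat x 0 s)"
    using exec.NAssign[of q x "NConst 0" s] by simp
  ultimately show ?thesis unfolding runs_def for_loop_def using exec.Seq by fastforce
qed


section \<open>The program\<close>

abbreviation "cell x \<equiv> RCell x (NConst 0)"
abbreviation "scalar x \<equiv> RCell x (NConst 0) (NConst 0)"

text \<open>Arrays: row 0 of \<open>A\<close> flags the items ever accepted, \<open>W\<close> stores the weights, \<open>X\<close> the stocks; \<open>v\<close>, \<open>p\<close>
  and \<open>L\<close> are scalars for the gain, the price and the load of a dimension.\<close>

definition probe :: com where
  "probe =
     Seq (Query ''q'' (NConst 0) (NConst 0) ''A'' (NConst 0))
    (Seq (RAssign ''A'' (NConst 0) (NVar ''t'') (RNat (NConst 1)))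
    (Seq (Query ''q'' (NConst 0) (NConst 1) ''A'' (NConst 0))
    (Seq (RAssign ''v'' (NConst 0) (NConst 0) (RMinus (cell ''q'' (NConst 1)) (scalar ''q'')))
         (RAssign ''p'' (NConst 0) (NConst 0) (RNat (NConst 0))))))"

text \<open>The array \<open>w\<close> is overwritten at the next arrival, so the same loop archives
  the weights in \<open>W\<close>.\<close>

definition appraise :: com where
  "appraise = for_loop ''i'' (NVar ''d'')
    (Seq (RAssign ''p'' (NConst 0) (NConst 0)
            (RPlus (scalar ''p'') (RTimes (cell ''w'' (NVar ''i'')) (cell ''X'' (NVar ''i'')))))
         (RAssign ''W'' (NVar ''t'') (NVar ''i'') (cell ''w'' (NVar ''i''))))"

definition credit :: com where
  "credit = for_loop ''i'' (NVar ''d'')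
    (Cond (RLess (RNat (NConst 0)) (cell ''w'' (NVar ''i'')))
       (RAssign ''X'' (NConst 0) (NVar ''i'') (RPlus (cell ''X'' (NVar ''i'')) (scalar ''v'')))
       Skip)"

text \<open>Flags are 0 or 1, so the product is the weight of an item still held and 0 for any
  other.\<close>

abbreviation "used \<equiv> RTimes (cell ''S'' (NVar ''j'')) (RCell ''W'' (NVar ''j'') (NVar ''i''))"

definition measure_load :: com where
  "measure_load =
     Seq (RAssign ''L'' (NConst 0) (NConst 0) (RNat (NConst 0)))
         (for_loop ''j'' (NPlus (NVar ''t'') (NConst 1))
           (RAssign ''L'' (NConst 0) (NConst 0) (RPlus (scalar ''L'') used)))"

text \<open>Ascending \<open>j\<close> means oldest first, and the bound \<open>t\<close> exempts
  the arriving item. Decreasing \<open>L\<close> along the way keeps the overflow test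
  current.\<close>

definition dispose :: com where
  "dispose = for_loop ''j'' (NVar ''t'')
     (Cond (BAnd (RLess (RNat (NConst 1)) (scalar ''L'')) (RLess (RNat (NConst 0)) used))
        (Seq (RAssign ''L'' (NConst 0) (NConst 0) (RMinus (scalar ''L'') used))
             (RAssign ''S'' (NConst 0) (NVar ''j'') (RNat (NConst 0))))
        Skip)"

text \<open>The load is measured afresh in each dimension, since disposals made for one dimension
  lower the loads of others.\<close>

definition trim :: com where
  "trim = for_loop ''i'' (NVar ''d'') (Seq measure_load dispose)"

definition accept :: com where
  "accept = Seq (RAssign ''S'' (NConst 0) (NVar ''t'') (RNat (NConst 1))) (Seq credit trim)"

text \<open>Undoes the flag that \<open>probe\<close> sets tentatively to query the value with the
  arriving item.\<close>

definition reject :: com where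
  "reject = RAssign ''A'' (NConst 0) (NVar ''t'') (RNat (NConst 0))"

definition packer :: com where
  "packer = Seq probe (Seq appraise
     (Cond (RLess (RTimes (scalar ''eps'') (scalar ''v'')) (RTimes (RNat (NConst 2)) (scalar ''p'')))
        reject accept))"


section \<open>Correctness of the program\<close>

context slack_instance
begin

text \<open>The memory between arrivals. Flags are prescribed at every index, so those of future
  items are 0 when \<open>A\<close> and \<open>S\<close> lie below \<open>m\<close>; scratch cells
  stay unconstrained.\<close>

definition idle :: "nat \<Rightarrow> nat set \<Rightarrow> nat set \<Rightarrow> store \<Rightarrow> bool" where
  "idle m A S s \<longleftrightarrow>
     (\<forall>j. reals s ''A'' 0 j = of_bool (j \<in> A)) \<and> (\<forall>j. reals s ''S'' 0 j = of_bool (j \<in> S)) \<and>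
     (\<forall>i<dim I. reals s ''X'' 0 i = stock A m i) \<and>
     (\<forall>j<m. \<forall>i<dim I. reals s ''W'' j i = wt j i)"

text \<open>The memory while item \<open>m\<close> is processed; \<open>r\<close> counts the entries of its weight vector already
  copied to \<open>W\<close>.\<close>

definition busy :: "nat \<Rightarrow> nat \<Rightarrow> nat set \<Rightarrow> nat set \<Rightarrow> (nat \<Rightarrow> real) \<Rightarrow> store \<Rightarrow> bool" where
  "busy m r A S x s \<longleftrightarrow>
     nats s ''d'' = dim I \<and> nats s ''t'' = m \<and> reals s ''eps'' 0 0 = \<epsilon> \<and>
     (\<forall>i<dim I. reals s ''w'' 0 i = wt m i) \<and>
     (\<forall>j. reals s ''A'' 0 j = of_bool (j \<in> A)) \<and> (\<forall>j. reals s ''S'' 0 j = of_bool (j \<in> S)) \<and>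
     (\<forall>i<dim I. reals s ''X'' 0 i = x i) \<and>
     (\<forall>j i. i < dim I \<and> (j < m \<or> j = m \<and> i < r) \<longrightarrow> reals s ''W'' j i = wt j i)"

section \<open>Effect of single writes on the memory\<close>

lemma busy_present:
  "idle m A S s \<Longrightarrow> busy m 0 A S (stock A m) (present \<epsilon> I m (arrivals I ! m) s)"
  by (auto simp: idle_def busy_def present_def wt_def)

lemma idle_finish: "busy m (dim I) A S (stock A (Suc m)) s \<Longrightarrow> idle (Suc m) A S s"
  by (auto simp: idle_def busy_def less_Suc_eq)

lemma busy_set_nat [simp]:
  "x \<noteq> ''d'' \<Longrightarrow> x \<noteq> ''t'' \<Longrightarrow> busy m r A S X (set_nat x k s) = busy m r A S X s"
  by (simp add: busy_def)

lemma busy_scratch [simp]: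
  "x \<notin> {''A'', ''S'', ''X'', ''W'', ''eps'', ''w''} \<Longrightarrow>
    busy m r A S X (set_cell x i j v s) = busy m r A S X s"
  by (simp add: busy_def)

lemma busy_insert_A: "busy m r A S x s \<Longrightarrow> busy m r (insert j A) S x (set_cell ''A'' 0 j 1 s)"
  by (auto simp: busy_def)

lemma busy_remove_A: "busy m r A S x s \<Longrightarrow> busy m r (A - {j}) S x (set_cell ''A'' 0 j 0 s)"
  by (auto simp: busy_def)

lemma busy_insert_S: "busy m r A S x s \<Longrightarrow> busy m r A (insert j S) x (set_cell ''S'' 0 j 1 s)"
  by (auto simp: busy_def)

lemma busy_remove_S: "busy m r A S x s \<Longrightarrow> busy m r A (S - {j}) x (set_cell ''S'' 0 j 0 s)"
  by (auto simp: busy_def)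

lemma busy_set_X: "busy m r A S x s \<Longrightarrow> busy m r A S (x(i := v)) (set_cell ''X'' 0 i v s)"
  by (auto simp: busy_def)

lemma busy_set_W: "busy m r A S x s \<Longrightarrow> busy m (Suc r) A S x (set_cell ''W'' m r (wt m r) s)"
  by (auto simp: busy_def less_Suc_eq)

lemma busyD:
  assumes "busy m r A S x s"
  shows "nats s ''d'' = dim I" "nats s ''t'' = m" "reals s ''eps'' 0 0 = \<epsilon>"
    "i < dim I \<Longrightarrow> reals s ''w'' 0 i = wt m i" "reals s ''A'' 0 j = of_bool (j \<in> A)"
    "reals s ''S'' 0 j = of_bool (j \<in> S)" "i < dim I \<Longrightarrow> reals s ''X'' 0 i = x i"
    "i < dim I \<Longrightarrow> j < m \<or> j = m \<and> i < r \<Longrightarrow> reals s ''W'' j i = wt j i"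
  using assms by (auto simp: busy_def)

section \<open>Queries and the phases of one arrival\<close>

lemma items_take:
  assumes "m \<le> n" "A \<subseteq> {..<m}"
  shows "{take m (arrivals I) ! j | j. j < length (take m (arrivals I)) \<and> j \<in> A} = items A"
proof -
  have "{take m (arrivals I) ! j | j. j < length (take m (arrivals I)) \<and> j \<in> A} =
      (!) (take m (arrivals I)) ` A"
    using assms by auto
  also have "\<dots> = items A" unfolding items_def using assms(2) by (intro image_cong) auto
  finally show ?thesis .
qed

lemma value_oracle_val:
  assumes "m < n" "A \<subseteq> {..m}"
  shows "value_oracle I (take (Suc m) (arrivals I)) (\<lambda>j. j \<in> A) = val A"
  using items_take[of "Suc m" A] assms by (simp only: value_oracle_def val_def lessThan_Suc_atMost Suc_le_eq)

lemma runs_probe: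
  assumes m: "m < n" and A: "A \<subseteq> {..<m}" and s: "busy m 0 A S x s"
  shows "runs (value_oracle I (take (Suc m) (arrivals I))) probe 5
    (\<lambda>s'. busy m 0 (insert m A) S x s' \<and> reals s' ''v'' 0 0 = gain A m \<and> reals s' ''p'' 0 0 = 0) s"
    (is "runs ?q _ _ _ _")
proof -
  have gain: "gain A m = val (insert m A) - val A"
    using A by (simp add: gain_def Int_absorb2)
  have sub: "A \<subseteq> {..m}" "insert m A \<subseteq> {..m}" using A by auto
  \<comment> \<open>The left side is the form in which simplification leaves the index set of the
    second query, where cell \<open>m\<close> has been overwritten by 1.\<close>
  have "(\<lambda>j. m \<noteq> j \<longrightarrow> j \<in> A) = (\<lambda>j. j \<in> insert m A)" by auto
  then have q1: "?q (\<lambda>j. j \<in> A) = val A" "?q (\<lambda>j. m \<noteq> j \<longrightarrow> j \<in> A) = val (insert m A)"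
    using value_oracle_val[OF m sub(1)] value_oracle_val[OF m sub(2)] by simp_all
  have "runs ?q probe (1 + (1 + (1 + (1 + 1))))
    (\<lambda>s'. busy m 0 (insert m A) S x s' \<and> reals s' ''v'' 0 0 = gain A m \<and> reals s' ''p'' 0 0 = 0) s"
    unfolding probe_def
    by (intro runs_Seq runs_Query runs_RAssign)
      (use s in \<open>simp add: busyD[OF s] q1 gain busy_insert_A\<close>)
  then show ?thesis by (rule runs_mono) auto
qed

lemma runs_appraise:
  assumes s: "busy m 0 A S x s" "reals s ''v'' 0 0 = v" "reals s ''p'' 0 0 = 0"
  shows "runs q appraise (dim I * 4 + 2) (\<lambda>s'. busy m (dim I) A S x s' \<and> reals s' ''v'' 0 0 = v \<and>
    reals s' ''p'' 0 0 = (\<Sum>i<dim I. wt m i * x i)) s"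
proof -
  \<comment> \<open>The loop counter doubles as the number of weights already copied.\<close>
  define Inv where "Inv i s \<longleftrightarrow> busy m i A S x s \<and> reals s ''v'' 0 0 = v \<and>
    reals s ''p'' 0 0 = (\<Sum>i<i. wt m i * x i)" for i s
  have "runs q appraise (dim I * (2 + 2) + 2) (\<lambda>s'. Inv (dim I) s') s"
    unfolding appraise_def
  proof (rule runs_for_loop[where Inv = Inv])
    fix i s assume i: "i < dim I" "Inv i s" "nats s ''i'' = i"
    have b: "busy m i A S x s" using i(2) by (simp add: Inv_def)
    have "runs q (Seq (RAssign ''p'' (NConst 0) (NConst 0)
            (RPlus (scalar ''p'') (RTimes (cell ''w'' (NVar ''i'')) (cell ''X'' (NVar ''i'')))))
         (RAssign ''W'' (NVar ''t'') (NVar ''i'') (cell ''w'' (NVar ''i'')))) (1 + 1)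
      (\<lambda>s'. nats s' ''i'' = i \<and> Inv (Suc i) (set_nat ''i'' (Suc i) s')) s"
      by (intro runs_Seq runs_RAssign)
        (use i b in \<open>simp add: Inv_def busyD[OF b] busy_set_W\<close>)
    then show "runs q (Seq (RAssign ''p'' (NConst 0) (NConst 0)
            (RPlus (scalar ''p'') (RTimes (cell ''w'' (NVar ''i'')) (cell ''X'' (NVar ''i'')))))
         (RAssign ''W'' (NVar ''t'') (NVar ''i'') (cell ''w'' (NVar ''i'')))) 2
      (\<lambda>s'. nats s' ''i'' = i \<and> Inv (Suc i) (set_nat ''i'' (Suc i) s')) s" by (simp only: one_add_one)
  qed (use s in \<open>auto simp: Inv_def busyD\<close>)
  then show ?thesis by (simp add: Inv_def)
qed

lemma runs_credit:
  assumes s: "busy m r A S x s" "reals s ''v'' 0 0 = v"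
  shows "runs q credit (dim I * 4 + 2)
    (busy m r A S (\<lambda>i. x i + (if 0 < wt m i then v else 0))) s"
proof -
  define Inv where "Inv i s \<longleftrightarrow> reals s ''v'' 0 0 = v \<and>
    busy m r A S (\<lambda>l. x l + (if l < i \<and> 0 < wt m l then v else 0)) s" for i s
  have "runs q credit (dim I * (Suc 1 + 2) + 2) (Inv (dim I)) s"
    unfolding credit_def
  proof (rule runs_for_loop[where Inv = Inv])
    fix i s assume i: "i < dim I" "Inv i s" "nats s ''i'' = i"
    let ?x = "\<lambda>i l. x l + (if l < i \<and> 0 < wt m l then v else 0)"
    have b: "busy m r A S (?x i) s" and v: "reals s ''v'' 0 0 = v" using i(2) by (auto simp: Inv_def)
    have pos: "?x (Suc i) = (?x i)(i := ?x i i + v)" if "0 < wt m i"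
      using that by (auto simp: fun_eq_iff less_Suc_eq)
    have neg: "?x (Suc i) = ?x i" if "\<not> 0 < wt m i"
      using that by (auto simp: fun_eq_iff less_Suc_eq)
    show "runs q (Cond (RLess (RNat (NConst 0)) (cell ''w'' (NVar ''i'')))
       (RAssign ''X'' (NConst 0) (NVar ''i'') (RPlus (cell ''X'' (NVar ''i'')) (scalar ''v'')))
       Skip) (Suc 1) (\<lambda>s'. nats s' ''i'' = i \<and> Inv (Suc i) (set_nat ''i'' (Suc i) s')) s"
    proof (intro runs_Cond runs_RAssign runs_Skip)
      assume "bval (RLess (RNat (NConst 0)) (cell ''w'' (NVar ''i''))) s"
      then have "0 < wt m i" using i busyD[OF b] by simp
      from busy_set_X[OF b, of i "?x i i + v", folded pos[OF this]]
      show "nats (set_cell ''X'' (nval (NConst 0) s) (nval (NVar ''i'') s)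
          (rval (RPlus (cell ''X'' (NVar ''i'')) (scalar ''v'')) s) s) ''i'' = i \<and>
        Inv (Suc i) (set_nat ''i'' (Suc i) (set_cell ''X'' (nval (NConst 0) s) (nval (NVar ''i'') s)
          (rval (RPlus (cell ''X'' (NVar ''i'')) (scalar ''v'')) s) s))"
        using i v busyD(7)[OF b i(1)] by (simp add: Inv_def)
    next
      assume "\<not> bval (RLess (RNat (NConst 0)) (cell ''w'' (NVar ''i''))) s"
      then have "\<not> 0 < wt m i" using i busyD[OF b] by simp
      from neg[OF this] show "nats s ''i'' = i \<and> Inv (Suc i) (set_nat ''i'' (Suc i) s)"
        using i b v by (simp add: Inv_def)
    qed simp
  qed (use s in \<open>auto simp: Inv_def busyD\<close>)
  then show ?thesis
    by (rule runs_mono) (auto simp: Inv_def busy_def)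
qed

lemma runs_measure_load:
  assumes s: "busy m (dim I) A S x s" "nats s ''i'' = i" and i: "i < dim I" and S: "S \<subseteq> {..m}"
  shows "runs q measure_load (Suc m * 3 + 3) (\<lambda>s'. busy m (dim I) A S x s' \<and> nats s' ''i'' = i \<and>
    reals s' ''L'' 0 0 = (\<Sum>l\<in>S. wt l i)) s"
proof -
  define Inv where "Inv j s \<longleftrightarrow> busy m (dim I) A S x s \<and> nats s ''i'' = i \<and>
    reals s ''L'' 0 0 = (\<Sum>l<j. of_bool (l \<in> S) * wt l i)" for j s
  \<comment> \<open>The loop adds up all indices through \<open>m\<close>; items not held contribute
    0.\<close>
  have "(\<Sum>l<Suc m. of_bool (l \<in> S) * wt l i) = (\<Sum>l\<in>S. wt l i)"
    by (rule sum.mono_neutral_cong_right) (use S in auto)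
  then have fin: "busy m (dim I) A S x s' \<and> nats s' ''i'' = i \<and> reals s' ''L'' 0 0 = (\<Sum>l\<in>S. wt l i)"
    if "Inv (Suc m) s'" for s'
    using that by (simp add: Inv_def)
  have "runs q measure_load (1 + (Suc m * (1 + 2) + 2)) (Inv (Suc m)) s"
    unfolding measure_load_def
  proof (intro runs_Seq runs_RAssign, rule runs_for_loop[where Inv = Inv])
    fix j s assume j: "j < Suc m" "Inv j s" "nats s ''j'' = j"
    have b: "busy m (dim I) A S x s" using j(2) by (simp add: Inv_def)
    have "reals s ''W'' j i = wt j i" using busyD(8)[OF b i] j(1) i by (simp add: less_Suc_eq)
    then show "runs q (RAssign ''L'' (NConst 0) (NConst 0) (RPlus (scalar ''L'') used)) 1
      (\<lambda>s'. nats s' ''j'' = j \<and> Inv (Suc j) (set_nat ''j'' (Suc j) s')) s"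
      by (intro runs_RAssign) (use j in \<open>simp add: Inv_def busyD(6)[OF b]\<close>)
  qed (use s in \<open>auto simp: Inv_def busyD\<close>)
  then show ?thesis by (rule runs_mono) (use fin in auto)
qed

text \<open>When \<open>j\<close> is disposed of, the load exceeds 1, older held items weigh nothing
  in dimension \<open>i\<close>, and \<open>j\<close> weighs at most \<open>1 - \<epsilon>\<close>.
  Hence the younger held items, all of them in \<open>A\<close>, weigh more than \<epsilon>, and
  \<open>j\<close> is superseded.\<close>

lemma runs_dispose:
  assumes s: "busy m (dim I) A S x s" "nats s ''i'' = i" "reals s ''L'' 0 0 = (\<Sum>l\<in>S. wt l i)"
    and i: "i < dim I" and m: "m < n" "m \<in> S" and S: "S \<subseteq> A" and A: "A \<subseteq> {..m}"
  shows "runs q dispose (m * 5 + 2) (\<lambda>s'. \<exists>U\<subseteq>S. m \<in> U \<and> busy m (dim I) A U x s' \<and> nats s' ''i'' = i \<and>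
    (\<Sum>l\<in>U. wt l i) \<le> 1 \<and> (\<forall>l\<in>S - U. superseded A i l)) s"
proof -
  have finA: "finite A" and finS: "finite S" using finite_subset[OF A] finite_subset[OF S] by auto
  have nonneg: "0 \<le> wt l i" if "l \<in> A" for l using that A m(1) i by (intro wt_nonneg) auto
  \<comment> \<open>The disjunction drives the loop: either the load already fits, or no held item
    before \<open>j\<close> uses dimension \<open>i\<close> any more.\<close>
  define R where "R j U L \<longleftrightarrow> U \<subseteq> S \<and> m \<in> U \<and> L = (\<Sum>l\<in>U. wt l i) \<and>
    (L \<le> 1 \<or> (\<forall>l\<in>U. l < j \<longrightarrow> wt l i = 0)) \<and> (\<forall>l\<in>S - U. superseded A i l)" for j U L
  define Inv where "Inv j s \<longleftrightarrow> nats s ''i'' = i \<and>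
    (\<exists>U. busy m (dim I) A U x s \<and> R j U (reals s ''L'' 0 0))" for j s
  have evict: "R (Suc j) (U - {j}) (L - wt j i)"
    if R: "R j U L" and j: "j < m" "j \<in> U" "1 < L" "0 < wt j i" for j U L
  proof -
    have U: "U \<subseteq> A" "finite U" using R S finite_subset[OF _ finS] by (auto simp: R_def)
    have L: "(\<Sum>l\<in>U - {j}. wt l i) = L - wt j i"
      using R U j(2) by (simp add: R_def sum_diff1)
    have zero: "wt l i = 0" if "l \<in> U" "l < j" for l using R that j(3) by (auto simp: R_def)
    have "\<epsilon> \<le> L - wt j i" using wt_le[of j i] j m i by simp
    also have "\<dots> = (\<Sum>l\<in>U - {j}. wt l i)" using L by simp
    also have "\<dots> = (\<Sum>l\<in>{l \<in> U. j < l}. wt l i)"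
    proof (rule sum.mono_neutral_right)
      show "\<forall>l\<in>U - {j} - {l \<in> U. j < l}. wt l i = 0"
        using zero by (metis DiffE insertI1 linorder_neqE_nat mem_Collect_eq)
    qed (use U in auto)
    also have "\<dots> \<le> (\<Sum>l\<in>{l \<in> A. j < l}. wt l i)"
      using U finA nonneg by (intro sum_mono2) auto
    finally have "superseded A i j" using j by (simp add: superseded_def)
    then show ?thesis using R L j zero by (auto simp: R_def less_Suc_eq)
  qed
  have stay: "R (Suc j) U L" if R: "R j U L" and j: "\<not> (1 < L \<and> j \<in> U \<and> 0 < wt j i)" for j U L
  proof -
    have "wt j i = 0" if "j \<in> U" "\<not> wt j i > 0"
      using nonneg[of j] that R S by (auto simp: R_def)
    then show ?thesis using R j by (fastforce simp: R_def less_Suc_eq)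
  qed
  \<comment> \<open>If the disjunct \<open>L \<le> 1\<close> fails at the end, only the arriving
    item \<open>m\<close> can still have weight in dimension \<open>i\<close>, and it fits alone by
    the slack.\<close>
  have final: "(\<Sum>l\<in>U. wt l i) \<le> 1" if R: "R m U L" for U L
  proof (cases "L \<le> 1")
    case True
    then show ?thesis using R by (simp add: R_def)
  next
    case False
    have U: "finite U" "U \<subseteq> {..m}" using R S A finite_subset[OF _ finS] by (auto simp: R_def)
    have "(\<Sum>l\<in>U. wt l i) = (\<Sum>l\<in>{m}. wt l i)"
      using R False U by (intro sum.mono_neutral_right) (auto simp: R_def le_less)
    then show ?thesis using wt_le[OF m(1) i] eps_pos by simp
  qed
  have "runs q dispose (m * (Suc 2 + 2) + 2) (Inv m) s"
    unfolding dispose_def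
  proof (rule runs_for_loop[where Inv = Inv])
    fix j s assume j: "j < m" "Inv j s" "nats s ''j'' = j"
    then obtain U where b: "busy m (dim I) A U x s" and R: "R j U (reals s ''L'' 0 0)"
      and ni: "nats s ''i'' = i" by (auto simp: Inv_def)
    have u: "rval used s = of_bool (j \<in> U) * wt j i" using j ni i by (simp add: busyD[OF b])
    show "runs q (Cond (BAnd (RLess (RNat (NConst 1)) (scalar ''L'')) (RLess (RNat (NConst 0)) used))
        (Seq (RAssign ''L'' (NConst 0) (NConst 0) (RMinus (scalar ''L'') used))
             (RAssign ''S'' (NConst 0) (NVar ''j'') (RNat (NConst 0))))
        Skip) (Suc 2) (\<lambda>s'. nats s' ''j'' = j \<and> Inv (Suc j) (set_nat ''j'' (Suc j) s')) s"
    proof (rule runs_Cond)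
      assume "bval (BAnd (RLess (RNat (NConst 1)) (scalar ''L'')) (RLess (RNat (NConst 0)) used)) s"
      then have c: "1 < reals s ''L'' 0 0" "j \<in> U" "0 < wt j i"
        using u by (auto simp: of_bool_def split: if_splits)
      let ?s = "set_cell ''S'' 0 j 0 (set_cell ''L'' 0 0 (reals s ''L'' 0 0 - wt j i) s)"
      have "busy m (dim I) A (U - {j}) x ?s" using b by (intro busy_remove_S) simp
      moreover note evict[OF R j(1) c(2,1,3)]
      ultimately have "Inv (Suc j) (set_nat ''j'' (Suc j) ?s)"
        unfolding Inv_def by (intro conjI exI[of _ "U - {j}"]) (use ni in auto)
      then have "runs q (Seq (RAssign ''L'' (NConst 0) (NConst 0) (RMinus (scalar ''L'') used))
             (RAssign ''S'' (NConst 0) (NVar ''j'') (RNat (NConst 0)))) (1 + 1)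
          (\<lambda>s'. nats s' ''j'' = j \<and> Inv (Suc j) (set_nat ''j'' (Suc j) s')) s"
        by (intro runs_Seq runs_RAssign) (use j u c in simp)
      then show "runs q (Seq (RAssign ''L'' (NConst 0) (NConst 0) (RMinus (scalar ''L'') used))
             (RAssign ''S'' (NConst 0) (NVar ''j'') (RNat (NConst 0)))) 2
          (\<lambda>s'. nats s' ''j'' = j \<and> Inv (Suc j) (set_nat ''j'' (Suc j) s')) s"
        by (simp only: one_add_one)
    next
      assume "\<not> bval (BAnd (RLess (RNat (NConst 1)) (scalar ''L'')) (RLess (RNat (NConst 0)) used)) s"
      then have "\<not> (1 < reals s ''L'' 0 0 \<and> j \<in> U \<and> 0 < wt j i)" using u by auto
      from stay[OF R this] have "Inv (Suc j) (set_nat ''j'' (Suc j) s)"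
        using b ni unfolding Inv_def by auto
      then show "runs q Skip 2 (\<lambda>s'. nats s' ''j'' = j \<and> Inv (Suc j) (set_nat ''j'' (Suc j) s')) s"
        using j by (intro runs_Skip) auto
    qed
  next
    show "Inv 0 (set_nat ''j'' 0 s)"
      using s m unfolding Inv_def R_def by (intro conjI exI[of _ S]) auto
  qed (auto simp: Inv_def busyD)
  then show ?thesis
  proof (rule runs_mono)
    fix s' assume "Inv m s'"
    then show "\<exists>U\<subseteq>S. m \<in> U \<and> busy m (dim I) A U x s' \<and> nats s' ''i'' = i \<and>
      (\<Sum>l\<in>U. wt l i) \<le> 1 \<and> (\<forall>l\<in>S - U. superseded A i l)"
      using final unfolding Inv_def R_def by blast
  qed simp
qed

text \<open>Disposals for later dimensions only lower loads, weights being nonnegative, so a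
  capacity once respected stays respected. The arriving item survives every round, as
  \<open>runs_dispose\<close> requires.\<close>

lemma runs_trim:
  assumes s: "busy m (dim I) A S x s"
    and m: "m < n" "m \<in> S" and S: "S \<subseteq> A" and A: "A \<subseteq> {..m}"
  shows "runs q trim (dim I * (8 * m + 10) + 2) (\<lambda>s'. \<exists>U\<subseteq>S. busy m (dim I) A U x s' \<and>
    (\<forall>i<dim I. (\<Sum>l\<in>U. wt l i) \<le> 1) \<and> (\<forall>l\<in>S - U. \<exists>i<dim I. superseded A i l)) s"
proof -
  define R where "R i U \<longleftrightarrow> U \<subseteq> S \<and> m \<in> U \<and> (\<forall>i'<i. (\<Sum>l\<in>U. wt l i') \<le> 1) \<and>
    (\<forall>l\<in>S - U. \<exists>i<dim I. superseded A i l)" for i U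
  define Inv where "Inv i s \<longleftrightarrow> (\<exists>U. busy m (dim I) A U x s \<and> R i U)" for i s
  have "runs q trim (dim I * (((Suc m * 3 + 3) + (m * 5 + 2)) + 2) + 2) (Inv (dim I)) s"
    unfolding trim_def
  proof (rule runs_for_loop[where Inv = Inv])
    fix i s assume i: "i < dim I" "Inv i s" "nats s ''i'' = i"
    then obtain U where b: "busy m (dim I) A U x s" and R: "R i U" by (auto simp: Inv_def)
    have U: "U \<subseteq> S" "m \<in> U" "U \<subseteq> A" "U \<subseteq> {..m}" using R S A by (auto simp: R_def)
    have finU: "finite U" using U(4) finite_subset by auto
    show "runs q (Seq measure_load dispose) ((Suc m * 3 + 3) + (m * 5 + 2))
      (\<lambda>s'. nats s' ''i'' = i \<and> Inv (Suc i) (set_nat ''i'' (Suc i) s')) s"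
    proof (rule runs_Seq, rule runs_mono[OF runs_measure_load[OF b i(3) i(1) U(4)] order_refl])
      fix s1 assume s1: "busy m (dim I) A U x s1 \<and> nats s1 ''i'' = i \<and> reals s1 ''L'' 0 0 = (\<Sum>l\<in>U. wt l i)"
      show "runs q dispose (m * 5 + 2) (\<lambda>s'. nats s' ''i'' = i \<and> Inv (Suc i) (set_nat ''i'' (Suc i) s')) s1"
      proof (rule runs_mono[OF runs_dispose[of m A U x s1 i] order_refl])
        fix s' assume "\<exists>V\<subseteq>U. m \<in> V \<and> busy m (dim I) A V x s' \<and> nats s' ''i'' = i \<and>
          (\<Sum>l\<in>V. wt l i) \<le> 1 \<and> (\<forall>l\<in>U - V. superseded A i l)"
        then obtain V where V: "V \<subseteq> U" "m \<in> V" "busy m (dim I) A V x s'" "nats s' ''i'' = i"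
          "(\<Sum>l\<in>V. wt l i) \<le> 1" "\<forall>l\<in>U - V. superseded A i l" by blast
        have "(\<Sum>l\<in>V. wt l i') \<le> 1" if "i' < i" for i'
        proof -
          have "(\<Sum>l\<in>V. wt l i') \<le> (\<Sum>l\<in>U. wt l i')"
            using that i V U m finU by (intro sum_mono2 wt_nonneg) auto
          also have "\<dots> \<le> 1" using R that by (simp add: R_def)
          finally show ?thesis .
        qed
        then have "R (Suc i) V" using R V i U unfolding R_def by (auto simp: less_Suc_eq) blast
        then show "nats s' ''i'' = i \<and> Inv (Suc i) (set_nat ''i'' (Suc i) s')"
          using V unfolding Inv_def by auto
      qed (use s1 i U A m in auto)
    qed
  next
    show "Inv 0 (set_nat ''i'' 0 s)"
      using s m unfolding Inv_def R_def by (intro exI[of _ S]) auto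
  qed (auto simp: Inv_def busyD)
  then show ?thesis
  proof (rule runs_mono)
    show "dim I * (Suc m * 3 + 3 + (m * 5 + 2) + 2) + 2 \<le> dim I * (8 * m + 10) + 2" by simp
  qed (auto simp: Inv_def R_def)
qed

text \<open>With \<open>d = dim I\<close>: 5 for \<open>probe\<close>, \<open>4 * d + 2\<close> for
  \<open>appraise\<close>, 1 for the test and \<open>d * (8 * m + 14) + 5\<close> for
  \<open>accept\<close>, the dearer branch.\<close>

definition step_time :: "nat \<Rightarrow> nat" where
  "step_time m = dim I * (8 * m + 18) + 13"

lemma runs_packer:
  assumes m: "m < n" and good: "good m A S" and idle: "idle m A S s"
  shows "runs (value_oracle I (take (Suc m) (arrivals I))) packer (step_time m)
    (\<lambda>s'. \<exists>A' S'. good (Suc m) A' S' \<and> idle (Suc m) A' S' s' \<and> S' \<subseteq> insert m S)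
    (present \<epsilon> I m (arrivals I ! m) s)" (is "runs ?q _ _ ?Q ?s")
proof -
  let ?A = "insert m A" and ?x = "stock A m"
  have A: "A \<subseteq> {..<m}" and S: "S \<subseteq> A" using good by (auto simp: good_def)
  have mA: "m \<notin> A" using A by auto
  have restrict: "?A \<inter> {..<j} = A \<inter> {..<j}" if "j \<le> m" for j using that by auto
  have b0: "busy m 0 A S ?x ?s" using idle by (rule busy_present)
  \<comment> \<open>Gains and prices look only at earlier indices, so the recorded decisions below
    \<open>m\<close> stay correct for any \<open>B\<close> that agrees with \<open>A\<close> there,
    in particular after inserting \<open>m\<close>.\<close>
  have decided: "\<forall>j<m. j \<in> B \<longleftrightarrow> 2 * price B j \<le> \<epsilon> * gain B j"
    if "\<And>j. j \<le> m \<Longrightarrow> B \<inter> {..<j} = A \<inter> {..<j}" for B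
  proof (intro allI impI)
    fix j assume j: "j < m"
    have "j \<in> B \<longleftrightarrow> j \<in> A" using that[of m] j by auto
    then show "j \<in> B \<longleftrightarrow> 2 * price B j \<le> \<epsilon> * gain B j"
      using good j price_cong[OF that[of j]] gain_cong[OF that[of j]] by (simp add: good_def)
  qed
  have rej: "runs ?q reject (dim I * (8 * m + 14) + 5) ?Q s'"
    if b: "busy m (dim I) ?A S ?x s'" and no: "\<epsilon> * gain A m < 2 * price A m" for s'
  proof -
    have "stock A (Suc m) = ?x" using mA by (auto simp: stock_Suc)
    then have "busy m (dim I) A S (stock A (Suc m)) (set_cell ''A'' 0 m 0 s')"
      using busy_remove_A[OF b, of m] mA by simp
    then have "idle (Suc m) A S (set_cell ''A'' 0 m 0 s')" by (rule idle_finish)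
    moreover have "good (Suc m) A S"
      using good no mA by (auto simp: good_def less_Suc_eq)
    ultimately have "?Q (set_cell ''A'' 0 m 0 s')" by blast
    then have "runs ?q reject 1 ?Q s'"
      unfolding reject_def by (intro runs_RAssign) (simp add: busyD[OF b])
    then show ?thesis by (rule runs_mono) auto
  qed
  have acc: "runs ?q accept (dim I * (8 * m + 14) + 5) ?Q s'"
    if b: "busy m (dim I) ?A S ?x s'" and v: "reals s' ''v'' 0 0 = gain A m"
      and yes: "2 * price A m \<le> \<epsilon> * gain A m" for s'
  proof -
    have x: "(\<lambda>i. ?x i + (if 0 < wt m i then gain A m else 0)) = stock ?A (Suc m)"
      using stock_cong[OF restrict[OF order_refl]] gain_cong[OF restrict[OF order_refl]]
      by (auto simp: stock_Suc)
    have "runs ?q accept (1 + ((dim I * 4 + 2) + (dim I * (8 * m + 10) + 2))) ?Q s'"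
      unfolding accept_def
    proof (intro runs_Seq runs_RAssign)
      let ?s1 = "set_cell ''S'' (nval (NConst 0) s') (nval (NVar ''t'') s') (rval (RNat (NConst 1)) s') s'"
      have b1: "busy m (dim I) ?A (insert m S) ?x ?s1" "reals ?s1 ''v'' 0 0 = gain A m"
        using busy_insert_S[OF b, of m] v by (auto simp: busyD[OF b])
      show "runs ?q credit (dim I * 4 + 2) (runs ?q trim (dim I * (8 * m + 10) + 2) ?Q) ?s1"
      proof (rule runs_mono[OF runs_credit[OF b1] order_refl])
        fix s2 assume "busy m (dim I) ?A (insert m S) (\<lambda>i. ?x i + (if 0 < wt m i then gain A m else 0)) s2"
        then have b2: "busy m (dim I) ?A (insert m S) (stock ?A (Suc m)) s2" unfolding x .
        show "runs ?q trim (dim I * (8 * m + 10) + 2) ?Q s2"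
        proof (rule runs_mono[OF runs_trim[OF b2 m] order_refl])
          fix s3 assume "\<exists>U\<subseteq>insert m S. busy m (dim I) ?A U (stock ?A (Suc m)) s3 \<and>
            (\<forall>i<dim I. (\<Sum>l\<in>U. wt l i) \<le> 1) \<and> (\<forall>l\<in>insert m S - U. \<exists>i<dim I. superseded ?A i l)"
          then obtain U where U: "U \<subseteq> insert m S" "busy m (dim I) ?A U (stock ?A (Suc m)) s3"
            "\<forall>i<dim I. (\<Sum>l\<in>U. wt l i) \<le> 1" "\<forall>l\<in>insert m S - U. \<exists>i<dim I. superseded ?A i l"
            by blast
          \<comment> \<open>Accepting \<open>m\<close> adds at most one nonnegative weight to the
            later load, so old justifications persist.\<close>
          have "superseded ?A i j" if "superseded A i j" "i < dim I" for i j
          proof -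
            have "(\<Sum>l\<in>{l \<in> A. j < l}. wt l i) \<le> (\<Sum>l\<in>{l \<in> ?A. j < l}. wt l i)"
            proof (rule sum_mono2)
              show "finite {l \<in> ?A. j < l}" using finite_subset[OF A] by simp
            qed (use wt_nonneg[OF m] that in auto)
            then show ?thesis using that by (simp add: superseded_def)
          qed
          \<comment> \<open>An accepted item no longer held was disposed of either before this
            arrival or during it.\<close>
          then have "\<forall>l\<in>?A - U. \<exists>i<dim I. superseded ?A i l"
            using good U(4) unfolding good_def by blast
          moreover have "2 * price ?A m \<le> \<epsilon> * gain ?A m"
            using yes price_cong[OF restrict[OF order_refl]] gain_cong[OF restrict[OF order_refl]] by simp
          ultimately have "good (Suc m) ?A U"
            using U S A decided[OF restrict] unfolding good_def by (auto simp: less_Suc_eq)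
          then show "?Q s3" using idle_finish[OF U(2)] U(1) by blast
        qed (use S A in auto)
      qed
    qed
    then show ?thesis by (rule runs_mono) (auto simp: algebra_simps)
  qed
  have "runs ?q packer (5 + ((dim I * 4 + 2) + Suc (dim I * (8 * m + 14) + 5))) ?Q ?s"
    unfolding packer_def
  proof (rule runs_Seq, rule runs_mono[OF runs_probe[OF m A b0] order_refl])
    fix s1 assume s1: "busy m 0 ?A S ?x s1 \<and> reals s1 ''v'' 0 0 = gain A m \<and> reals s1 ''p'' 0 0 = 0"
    show "runs ?q (Seq appraise (Cond (RLess (RTimes (scalar ''eps'') (scalar ''v''))
        (RTimes (RNat (NConst 2)) (scalar ''p''))) reject accept))
      ((dim I * 4 + 2) + Suc (dim I * (8 * m + 14) + 5)) ?Q s1"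
    proof (rule runs_Seq, rule runs_mono[OF runs_appraise order_refl])
      fix s2 assume s2: "busy m (dim I) ?A S ?x s2 \<and> reals s2 ''v'' 0 0 = gain A m \<and>
        reals s2 ''p'' 0 0 = (\<Sum>i<dim I. wt m i * ?x i)"
      then have "reals s2 ''p'' 0 0 = price A m" "reals s2 ''eps'' 0 0 = \<epsilon>"
        by (auto simp: price_def busyD)
      then show "runs ?q (Cond (RLess (RTimes (scalar ''eps'') (scalar ''v''))
        (RTimes (RNat (NConst 2)) (scalar ''p''))) reject accept) (Suc (dim I * (8 * m + 14) + 5)) ?Q s2"
        using s2 by (intro runs_Cond rej acc) auto
    qed (use s1 in auto)
  qed
  then show ?thesis by (rule runs_mono) (auto simp: step_time_def algebra_simps)
qed

section \<open>The whole run: feasibility, irrevocability, time and ratio\<close>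

lemma kept_idle:
  assumes "idle m A S s" "S \<subseteq> {..<m}" "m \<le> n"
  shows "kept (take m (arrivals I)) s = items S"
  unfolding kept_def items_take[OF assms(3,2), symmetric] using assms(1) by (simp add: idle_def)

lemma feasible_items:
  assumes "good m A S" "m \<le> n"
  shows "feasible I (items S)"
proof -
  have "S \<subseteq> {..<n}" using assms by (auto simp: good_def)
  then have "(\<Sum>u\<in>items S. weight I u i) = (\<Sum>l\<in>S. wt l i)" for i
    unfolding items_def using sum.reindex[OF inj_arrivals] by (simp add: wt_def)
  then show ?thesis using assms(1) by (simp add: good_def feasible_def)
qed

text \<open>Induction over prefixes, since \<open>online_run\<close> grows at the end. Every arrival
  is charged the uniform budget \<open>step_time n\<close>, which dominates
  \<open>step_time m\<close>.\<close>

lemma online_run_packer: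
  "m \<le> n \<Longrightarrow> \<exists>s Ss T A S. online_run packer \<epsilon> I (take m (arrivals I)) s Ss T \<and>
     good m A S \<and> idle m A S s \<and> T \<le> m * step_time n \<and> length Ss = Suc m \<and> last Ss = items S \<and>
     (\<forall>j<m. Ss ! Suc j \<subseteq> insert (arrivals I ! j) (Ss ! j)) \<and> (\<forall>S\<in>set Ss. feasible I S)"
proof (induction m)
  case 0
  have "good 0 {} {}" by (simp add: good_def)
  moreover have "idle 0 {} {} initial_store" by (simp add: idle_def initial_store_def stock_def)
  ultimately show ?case using online_run.start[of packer \<epsilon> I]
    by (intro exI[of _ initial_store] exI[of _ "[{}]"] exI[of _ 0] exI[of _ "{}"])
      (auto simp: items_def feasible_def)
next
  case (Suc m)
  then have m: "m < n" by simp
  let ?us = "take m (arrivals I)" and ?u = "arrivals I ! m"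
  obtain s Ss T A S where run: "online_run packer \<epsilon> I ?us s Ss T" and IH: "good m A S" "idle m A S s"
    "T \<le> m * step_time n" "length Ss = Suc m" "last Ss = items S"
    "\<forall>j<m. Ss ! Suc j \<subseteq> insert (arrivals I ! j) (Ss ! j)" "\<forall>S\<in>set Ss. feasible I S"
    using Suc by auto
  have us: "?us @ [?u] = take (Suc m) (arrivals I)" using m by (simp add: take_Suc_conv_app_nth)
  obtain t s' A' S' where t: "exec (value_oracle I (?us @ [?u])) packer (present \<epsilon> I (length ?us) ?u s) t s'"
    "t \<le> step_time m" and G: "good (Suc m) A' S'" "idle (Suc m) A' S' s'" "S' \<subseteq> insert m S"
    using runs_packer[OF m IH(1,2)] m unfolding runs_def us by auto
  let ?Ss = "Ss @ [kept (?us @ [?u]) s']"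
  have kept: "kept (?us @ [?u]) s' = items S'"
    unfolding us using G m by (intro kept_idle) (auto simp: good_def)
  have "online_run packer \<epsilon> I (take (Suc m) (arrivals I)) s' ?Ss (T + t)"
    using online_run.arrive[OF run t(1)] us by simp
  moreover have "step_time m \<le> step_time n" using m by (simp add: step_time_def)
  then have "T + t \<le> Suc m * step_time n" using IH(3) t(2) by simp
  \<comment> \<open>The last entry of a list of length \<open>Suc m\<close>; it turns
    \<open>S' \<subseteq> insert m S\<close> into irrevocability at the new arrival.\<close>
  moreover have "Ss ! m = items S" using IH(4,5) by (metis diff_Suc_1 last_conv_nth list.size(3) nat.simps(3))
  then have "\<forall>j<Suc m. ?Ss ! Suc j \<subseteq> insert (arrivals I ! j) (?Ss ! j)"
    using IH(4,6) G(3) by (auto simp: nth_append less_Suc_eq kept items_def)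
  moreover have "feasible I (items S')" using G(1) m by (intro feasible_items) auto
  ultimately show ?case using G IH(4,7) kept
    by (intro exI[of _ s'] exI[of _ ?Ss] exI[of _ "T + t"] exI[of _ A'] exI[of _ S']) auto
qed

lemma packer_run:
  obtains s Ss T A S where "online_run packer \<epsilon> I (arrivals I) s Ss T"
    "good n A S" "T \<le> n * step_time n" "last Ss = items S"
    "\<forall>j<n. Ss ! Suc j \<subseteq> insert (arrivals I ! j) (Ss ! j)" "\<forall>S\<in>set Ss. feasible I S"
  using online_run_packer[OF order_refl] by auto

text \<open>By determinism any run is the one already exhibited.\<close>

lemma packer_time:
  assumes "online_run packer \<epsilon> I (arrivals I) s Ss T"
  shows "T \<le> n * step_time n"
  using packer_run online_run_deterministic[OF assms] by metis

lemma packer_ratio: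
  assumes "online_run packer \<epsilon> I (arrivals I) s Ss T"
  shows "ennreal (opt_value I) / ennreal (utility I (last Ss)) \<le>
    ennreal (6 * real (max 1 (sparsity I)) / \<epsilon>\<^sup>2)"
proof -
  obtain A S where S: "good n A S" "last Ss = items S"
    using packer_run online_run_deterministic[OF assms] by metis
  let ?c = "6 * real (max 1 (sparsity I)) / \<epsilon>\<^sup>2"
  have u: "utility I (last Ss) = val S" using S(2) by (simp add: val_def)
  have "0 \<le> val S" using S(1) by (intro val_nonneg) (auto simp: good_def)
  have e2: "\<epsilon>\<^sup>2 \<le> \<epsilon>" "\<epsilon>\<^sup>2 \<le> 1" using eps_pos eps_le_1
    by (auto simp: power2_eq_square mult_le_one mult_left_le)
  \<comment> \<open>The constant 6 is 2 + 4: since \<epsilon> is at most 1, dividing by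
    \<open>\<epsilon>\<^sup>2\<close> only enlarges both summands. The \<open>max\<close> keeps the
    summand 2 covered at sparsity 0.\<close>
  have "2 + 4 * real (sparsity I) / \<epsilon> \<le> 2 * real (max 1 (sparsity I)) / \<epsilon>\<^sup>2 + 4 * real (max 1 (sparsity I)) / \<epsilon>\<^sup>2"
  proof (rule add_mono)
    show "2 \<le> 2 * real (max 1 (sparsity I)) / \<epsilon>\<^sup>2"
      using e2 eps_pos by (simp add: le_divide_eq)
    show "4 * real (sparsity I) / \<epsilon> \<le> 4 * real (max 1 (sparsity I)) / \<epsilon>\<^sup>2"
      using e2 eps_pos by (intro frac_le) auto
  qed
  also have "\<dots> = ?c" by (simp add: add_divide_distrib[symmetric])
  finally have "(2 + 4 * real (sparsity I) / \<epsilon>) * val S \<le> ?c * val S"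
    using \<open>0 \<le> val S\<close> by (intro mult_right_mono)
  with opt_le[OF S(1)] have opt: "opt_value I \<le> ?c * val S" by simp
  show ?thesis
  \<comment> \<open>A worthless solution forces an optimum of at most 0, and then the quotient is 0
    by the convention for \<open>0 / 0\<close>.\<close>
  proof (cases "val S = 0")
    case True
    then show ?thesis using opt u by (simp add: ennreal_neg)
  next
    case False
    then have "0 < val S" using \<open>0 \<le> val S\<close> by simp
    show ?thesis
    proof (cases "0 \<le> opt_value I")
      case True
      then show ?thesis unfolding u using \<open>0 < val S\<close> opt
        by (simp add: divide_ennreal ennreal_leI pos_divide_le_eq)
    qed (simp add: ennreal_neg)
  qed
qed

end

theorem theorem1p1:
  shows "\<exists>C::real. 0 < C \<and> (\<forall>\<epsilon>::real. 0 < \<epsilon> \<and> \<epsilon> \<le> 1 \<longrightarrow>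
    (\<exists>P. online_algorithm \<epsilon> P \<and> polynomial_time \<epsilon> P \<and>
      (\<forall>k. competitive_ratio \<epsilon> P k \<le> ennreal (C * real (max 1 k) / \<epsilon>\<^sup>2))))"
proof (intro exI[of _ "6::real"] conjI allI impI exI[of _ packer])
  \<comment> \<open>One program serves every \<epsilon>, whose value it reads from the array
    \<open>eps\<close>.\<close>
  fix \<epsilon> :: real assume eps: "0 < \<epsilon> \<and> \<epsilon> \<le> 1"
  have loc: "slack_instance I \<epsilon>" if "packing_instance I \<and> has_slack \<epsilon> I" for I
    using that eps by unfold_locales auto
  show "online_algorithm \<epsilon> packer"
    unfolding online_algorithm_def using slack_instance.packer_run[OF loc] by metis
  show "polynomial_time \<epsilon> packer"
    unfolding polynomial_time_def
  \<comment> \<open>With \<open>N = n + d\<close>, the polynomial is \<open>N\<close> arrivals times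
    \<open>13 * (1 + 2 * N) * (1 + N)\<close>, a generous bound on
    \<open>step_time n\<close>.\<close>
  proof (intro exI[of _ "[:0, 13:] * [:1, 2:] * [:1, 1:] :: nat poly"] allI impI)
    fix I s Ss T
    assume *: "packing_instance I \<and> has_slack \<epsilon> I \<and> online_run packer \<epsilon> I (arrivals I) s Ss T"
    let ?n = "length (arrivals I)" and ?N = "length (arrivals I) + dim I"
    interpret slack_instance I \<epsilon> using loc * by blast
    have "T \<le> ?n * step_time ?n" using packer_time * by blast
    also have "\<dots> \<le> ?N * (13 * ((1 + 2 * ?N) * (1 + ?N)))"
    proof (rule mult_le_mono)
      show "step_time ?n \<le> 13 * ((1 + 2 * ?N) * (1 + ?N))"
        unfolding step_time_def by (simp add: algebra_simps)
    qed simp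
    also have "\<dots> = poly ([:0, 13:] * [:1, 2:] * [:1, 1:]) ?N" by (simp add: algebra_simps)
    finally show "T \<le> poly ([:0, 13:] * [:1, 2:] * [:1, 1:]) ?N" .
  qed
  show "competitive_ratio \<epsilon> packer k \<le> ennreal (6 * real (max 1 k) / \<epsilon>\<^sup>2)" for k
    unfolding competitive_ratio_def
    by (rule Sup_least) (use slack_instance.packer_ratio[OF loc] in auto)
qed simp

end
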